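(* Let $G$ be a finite non-abelian $2$-group such that $\mathcal{GP}(G)$ is planar. Then $G\cong D_8$.
   Context: For a group $G$, the generalized power graph $\mathcal{GP}(G)$ is the simple undirected graph whose vertices are the non-identity elements of $G$, two distinct vertices $a,b$ being adjacent if and only if $\langle a\rangle\cap\langle b\rangle\neq 1$. $D_8$ denotes the dihedral group of order $8$. *)

theory Defs
  imports "HOL-Analysis.Analysis" "HOL-Algebra.Algebra"
begin

text \<open>A simple graph is given by its vertex set and its set of edges, each edge being a
  two-element set of vertices.\<close>

definition gpg_verts :: "('a, 'm) monoid_scheme \<Rightarrow> 'a set" where
  "gpg_verts G = carrier G - {\<one>\<^bsub>G\<^esub>}"

definition gpg_edges :: "('a, 'm) monoid_scheme \<Rightarrow> 'a set set" where
  "gpg_edges G = {{a, b} | a b. a \<in> gpg_verts G \<and> b \<in> gpg_verts G \<and> a \<noteq> b \<and>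
     generate G {a} \<inter> generate G {b} \<noteq> {\<one>\<^bsub>G\<^esub>}}"

text \<open>Planarity is topological. The plane is the type of complex numbers, as in the library's
  Jordan curve theorem. Vertices are drawn as distinct points and each edge as an arc
  joining its two ends; the relative interior of such an arc (the arc without its two end points)
  contains no vertex and no point of any other edge.\<close>

definition plane_drawing ::
  "'v set \<Rightarrow> 'v set set \<Rightarrow> ('v \<Rightarrow> complex) \<Rightarrow> ('v set \<Rightarrow> real \<Rightarrow> complex) \<Rightarrow> bool" where
  "plane_drawing V E p \<gamma> \<longleftrightarrow>
     inj_on p V \<and>
     (\<forall>e\<in>E. arc (\<gamma> e) \<and> {pathstart (\<gamma> e), pathfinish (\<gamma> e)} = p ` e) \<and>
     (\<forall>e\<in>E. (path_image (\<gamma> e) - p ` e) \<inter> p ` V = {}) \<and>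
     (\<forall>e\<in>E. \<forall>f\<in>E. e \<noteq> f \<longrightarrow> (path_image (\<gamma> e) - p ` e) \<inter> path_image (\<gamma> f) = {})"

definition planar :: "'v set \<Rightarrow> 'v set set \<Rightarrow> bool" where
  "planar V E \<longleftrightarrow> (\<exists>p \<gamma>. plane_drawing V E p \<gamma>)"

text \<open>The dihedral group of order \<open>2 * n\<close> (for \<open>n > 0\<close>): the pair \<open>(i, s)\<close> stands for
  \<open>r\<^sup>i\<close> if \<open>s\<close> is false and for \<open>r\<^sup>i t\<close> if \<open>s\<close> is true, where \<open>r\<close> is the rotation of order
  \<open>n\<close> and \<open>t\<close> a reflection, so that \<open>t r = r\<^sup>-\<^sup>1 t\<close>.\<close>

definition dihedral_group :: "nat \<Rightarrow> (int \<times> bool) monoid" where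
  "dihedral_group n =
     \<lparr>carrier = {0..<int n} \<times> UNIV,
      mult = (\<lambda>(i, s) (j, t). ((if s then i - j else i + j) mod int n, s \<noteq> t)),
      one = (0, False)\<rparr>"

abbreviation D8 :: "(int \<times> bool) monoid" where
  "D8 \<equiv> dihedral_group 4"

lemma group_dihedral_group:
  assumes "n > 0"
  shows "group (dihedral_group n)"
proof (rule groupI)
  fix x assume "x \<in> carrier (dihedral_group n)"
  then obtain i s where x: "x = (i, s)" "0 \<le> i" "i < int n"
    by (auto simp: dihedral_group_def)
  show "\<exists>y\<in>carrier (dihedral_group n). y \<otimes>\<^bsub>dihedral_group n\<^esub> x = \<one>\<^bsub>dihedral_group n\<^esub>"
    using assms x
    by (intro bexI[of _ "(if s then i else (- i) mod int n, s)"])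
      (auto simp: dihedral_group_def mod_simps)
next
  fix x y z assume "x \<in> carrier (dihedral_group n)" "y \<in> carrier (dihedral_group n)"
    "z \<in> carrier (dihedral_group n)"
  then show "x \<otimes>\<^bsub>dihedral_group n\<^esub> y \<otimes>\<^bsub>dihedral_group n\<^esub> z
    = x \<otimes>\<^bsub>dihedral_group n\<^esub> (y \<otimes>\<^bsub>dihedral_group n\<^esub> z)"
    by (auto simp: dihedral_group_def mod_simps algebra_simps)
qed (use assms in \<open>auto simp: dihedral_group_def\<close>)

lemma order_dihedral_group: "Coset.order (dihedral_group n) = 2 * n"
  by (simp add: Coset.order_def dihedral_group_def card_cartesian_product)

end

(*
  Five pairwise adjacent vertices cannot be drawn in the plane.  Let a, b, c, d, w be drawn with all
  edges and consider the closed curve through a, c, b, d.  A chord from a to b and a path from c to d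
  never lie on the same side of it, by the theta-curve theorem if both are inside, and after an
  inversion centred at an inside point if both are outside.  Hence the edge ab, the edge cd and the
  vertex w lie on pairwise opposite sides, but there are only two sides.

  Elements having a common nontrivial power form a clique, so there are at most four of them.  This
  excludes elements of order 8 and makes a square root of an involution unique up to inversion.  Let z
  be a central involution.  If x has order 4 then (xz)^2 = x^2, which forces x^2 = z.  Hence x and its
  inverse are the only elements of order 4, so every element outside <x> is an involution inverting x;
  the product of two such elements centralises x, so <x> has index 2.
*)
theory Submission
  imports Defs
begin

section \<open>Sides of closed curves in the plane and their chords\<close>

lemma connected_same_side:
  assumes "connected T" "T \<inter> C = {}" "x \<in> T" "y \<in> T"
  shows "x \<in> inside C \<longleftrightarrow> y \<in> inside C"
proof -
  have "x \<in> inside C \<union> outside C" "y \<in> inside C \<union> outside C"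
    using assms by auto
  then show ?thesis
    using inside_outside_intersect_connected[OF assms(1), of C] assms inside_Int_outside[of C] by blast
qed

text \<open>An arc stays connected when its two ends are removed, so between them it cannot change
  sides without meeting \<open>C\<close>.\<close>

lemma arc_points_same_side:
  assumes "arc g" "path_image g \<inter> C \<subseteq> {pathstart g, pathfinish g}"
    and "x \<in> path_image g - {pathstart g, pathfinish g}"
    and "y \<in> path_image g - {pathstart g, pathfinish g}"
  shows "x \<in> inside C \<longleftrightarrow> y \<in> inside C"
  by (rule connected_same_side[OF connected_simple_path_endless[of g]])
    (use assms arc_imp_simple_path in auto)

text \<open>The open unit interval is dense in the closed one and \<open>g\<close> is continuous.
  This puts the ends of a chord into the closure of any region that contains the rest of it.\<close>

lemma path_image_subset_closure_endless:
  assumes "simple_path g"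
  shows "path_image g \<subseteq> closure (path_image g - {pathstart g, pathfinish g})"
proof -
  have "g ` closure {0<..<1} \<subseteq> closure (g ` {0<..<1})"
    by (rule image_closure_subset)
      (use assms simple_path_imp_path closure_subset[of "g ` {0<..<1}"] in \<open>auto simp: path_def\<close>)
  then show ?thesis
    unfolding simple_path_endless[OF assms] by (simp add: path_image_def)
qed

lemma simple_closed_two_arcs:
  assumes "arc c1" "pathstart c1 = a" "pathfinish c1 = b"
    and "arc c2" "pathstart c2 = a" "pathfinish c2 = b"
    and "path_image c1 \<inter> path_image c2 = {a, b}"
  shows "simple_path (c1 +++ reversepath c2)"
    "pathfinish (c1 +++ reversepath c2) = pathstart (c1 +++ reversepath c2)"
    "path_image (c1 +++ reversepath c2) = path_image c1 \<union> path_image c2"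
  using assms by (auto simp: simple_path_join_loop_eq arc_reversepath path_image_join)

text \<open>If \<open>P\<close> runs inside, the theta-curve theorem cuts the inside along
  \<open>P\<close> into the insides of \<open>c1\<close> with \<open>P\<close> and of
  \<open>c2\<close> with \<open>P\<close>. Since \<open>Q\<close> cannot cross \<open>P\<close>, all
  of \<open>Q\<close> except its ends stays in one piece; but one end of \<open>Q\<close> lies on
  the other boundary arc, off the closure of that piece.\<close>

lemma chords_not_both_inside:
  fixes c1 c2 P Q :: "real \<Rightarrow> complex"
  assumes c1: "arc c1" "pathstart c1 = a" "pathfinish c1 = b"
    and c2: "arc c2" "pathstart c2 = a" "pathfinish c2 = b"
    and P: "arc P" "pathstart P = a" "pathfinish P = b"
    and Q: "arc Q" "pathstart Q = c" "pathfinish Q = d"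
    and c12: "path_image c1 \<inter> path_image c2 = {a, b}"
    and c1P: "path_image c1 \<inter> path_image P = {a, b}"
    and c2P: "path_image c2 \<inter> path_image P = {a, b}"
    and c: "c \<in> path_image c1 - {a, b}" and d: "d \<in> path_image c2 - {a, b}"
    and Q_int: "path_image Q \<inter> (path_image c1 \<union> path_image c2 \<union> path_image P) \<subseteq> {c, d}"
    and p: "p \<in> path_image P - {a, b}" and q: "q \<in> path_image Q - {c, d}"
  shows "\<not> (p \<in> inside (path_image c1 \<union> path_image c2) \<and> q \<in> inside (path_image c1 \<union> path_image c2))"
proof
  let ?I = "inside (path_image c1 \<union> path_image c2)"
  let ?I1 = "inside (path_image c1 \<union> path_image P)"
  let ?I2 = "inside (path_image c2 \<union> path_image P)"
  assume pq: "p \<in> ?I \<and> q \<in> ?I"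
  have "a \<noteq> b" using c1 arc_distinct_ends by blast
  have "path_image P \<inter> ?I \<noteq> {}" using p pq by blast
  from split_inside_simple_closed_curve[OF arc_imp_simple_path[OF c1(1)] c1(2,3)
      arc_imp_simple_path[OF c2(1)] c2(2,3) arc_imp_simple_path[OF P(1)] P(2,3) \<open>a \<noteq> b\<close> c12 c1P c2P this]
  have split: "?I1 \<union> ?I2 \<union> (path_image P - {a, b}) = ?I" by metis
  have cdI: "c \<notin> ?I" "d \<notin> ?I"
    using c d inside_no_overlap[of "path_image c1 \<union> path_image c2"] by blast+
  \<comment> \<open>The end of \<open>Q\<close> off the cycle \<open>e \<union> P\<close> lies outside it, whereas \<open>q\<close> lies inside.\<close>
  have crossing: False
    if e: "x \<in> path_image Q" "x \<notin> path_image e \<union> path_image P" "x \<notin> ?I" "{c, d} = {x, y}" "arc e"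
      and side: "q \<in> inside (path_image e \<union> path_image P)" "inside (path_image e \<union> path_image P) \<subseteq> ?I"
      and e12: "path_image e \<subseteq> path_image c1 \<union> path_image c2"
    for e x y
  proof -
    let ?J = "inside (path_image e \<union> path_image P)"
    have J: "closure ?J \<subseteq> path_image e \<union> path_image P \<union> ?J"
      using closure_inside_subset[of "path_image e \<union> path_image P"] e(5) P(1)
      by (simp add: closed_arc_image closed_Un)
    have "path_image Q - {c, d} \<subseteq> ?J"
    proof
      fix z assume "z \<in> path_image Q - {c, d}"
      then have "z \<in> ?J \<longleftrightarrow> q \<in> ?J"
        using arc_points_same_side[of Q "path_image e \<union> path_image P" z q] Q q Q_int e12 by blast
      with side(1) show "z \<in> ?J" by simp
    qed
    then have "closure (path_image Q - {c, d}) \<subseteq> closure ?J" by (rule closure_mono)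
    moreover have "path_image Q \<subseteq> closure (path_image Q - {c, d})"
      using path_image_subset_closure_endless[of Q] Q arc_imp_simple_path by auto
    ultimately have "x \<in> closure ?J" using e(1) by blast
    then show False using J e side(2) by blast
  qed
  have ends: "c \<in> path_image Q" "d \<in> path_image Q"
    using Q pathstart_in_path_image[of Q] pathfinish_in_path_image[of Q] by auto
  have "q \<notin> path_image P" using q Q_int by blast
  then consider "q \<in> ?I1" | "q \<in> ?I2" using split pq by blast
  then show False
  proof cases
    case 1
    have "d \<notin> path_image c1 \<union> path_image P" using d c12 c2P by blast
    then show False using crossing[of d c1 c] 1 ends cdI c1 split by blast
  next
    case 2
    have "c \<notin> path_image c2 \<union> path_image P" using c c12 c1P by blast
    then show False using crossing[of c c2 d] 2 ends cdI c2 split by blast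
  qed
qed

text \<open>The inversion at \<open>w\<close> maps the outside to a connected set that misses the
  image curve, so it is enough that one outside point lands inside that curve. The preimage of any
  nonzero point inside the image curve serves: were it inside the original curve, the punctured
  inside would be mapped into a bounded set, yet the inversion is unbounded near
  \<open>w\<close>.\<close>

lemma inversion_outside:
  fixes g :: "real \<Rightarrow> complex"
  assumes g: "simple_path g" "pathfinish g = pathstart g"
    and w: "w \<in> inside (path_image g)" and p: "p \<in> outside (path_image g)"
  shows "inverse (p - w) \<in> inside ((\<lambda>z. inverse (z - w)) ` path_image g)"
proof -
  let ?f = "\<lambda>z. inverse (z - w)"
  let ?C = "path_image g"
  have wC: "w \<notin> ?C" using w inside_no_overlap[of ?C] by blast
  have cont: "continuous_on S ?f" if "w \<notin> S" for S
    using that by (auto intro!: continuous_intros)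
  \<comment> \<open>This includes the pole \<open>w\<close>: \<open>inverse 0 = 0\<close>, and no
    other point has the value 0.\<close>
  have inj: "inj_on ?f S" for S by (auto simp: inj_on_def)
  have "simple_path (?f \<circ> g)"
    by (rule simple_path_continuous_image[OF g(1) cont[OF wC] inj])
  then have "inside (path_image (?f \<circ> g)) \<noteq> {}" "open (inside (path_image (?f \<circ> g)))"
    "bounded (inside (path_image (?f \<circ> g)))"
    using Jordan_inside_outside[of "?f \<circ> g"] g(2) by (auto simp: pathfinish_compose pathstart_compose)
  then have J: "inside (?f ` ?C) \<noteq> {}" "open (inside (?f ` ?C))" "bounded (inside (?f ` ?C))"
    by (auto simp: path_image_compose)
  \<comment> \<open>A nonempty open set is not contained in \<open>{0}\<close>. That
    \<open>y\<close> is nonzero keeps its preimage \<open>x\<close> away from the pole.\<close>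
  then obtain y where y: "y \<in> inside (?f ` ?C)" "y \<noteq> 0"
    by (metis not_open_singleton subset_singletonD subsetI singletonI)
  define x where "x = w + inverse y"
  have x: "?f x = y" "x \<noteq> w" using y by (auto simp: x_def)
  have JI: "open (inside ?C)" "connected (inside ?C)" "connected (outside ?C)"
    using Jordan_inside_outside[OF g] by auto
  have "x \<notin> ?C" using y(1) x inside_no_overlap[of "?f ` ?C"] by blast
  have "x \<in> outside ?C"
  proof (rule ccontr)
    assume "x \<notin> outside ?C"
    then have xI: "x \<in> inside ?C" using \<open>x \<notin> ?C\<close> inside_Un_outside[of ?C] by blast
    have "connected (?f ` (inside ?C - {w}))"
      by (intro connected_continuous_image cont connected_open_delete JI) auto
    moreover have "?f ` (inside ?C - {w}) \<inter> ?f ` ?C = {}"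
      using inside_no_overlap[of ?C] inj[of UNIV] unfolding inj_on_def by fast
    moreover have "y \<in> ?f ` (inside ?C - {w})" using xI x by auto
    ultimately have sub: "?f ` (inside ?C - {w}) \<subseteq> inside (?f ` ?C)"
      using connected_same_side y(1) by blast
    obtain B where B: "B > 0" "\<And>v. v \<in> inside (?f ` ?C) \<Longrightarrow> norm v \<le> B"
      using J(3) unfolding bounded_pos by blast
    obtain r where r: "r > 0" "ball w r \<subseteq> inside ?C"
      using JI(1) w open_contains_ball by blast
    \<comment> \<open>The bound \<open>r / 2\<close> keeps \<open>w + e\<close> in the disc, and
      \<open>1 / (2 * B)\<close> gives its image a modulus \<open>1 / e\<close> exceeding
      \<open>B\<close>.\<close>
    define e where "e = min (r / 2) (1 / (2 * B))"
    have e: "e > 0" "e < r" "e * B < 1"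
      using r B by (auto simp: e_def min_def field_simps)
    have "w + of_real e \<in> inside ?C - {w}" using r e by (auto simp: dist_norm)
    then have "norm (?f (w + of_real e)) \<le> B" using sub B by blast
    then show False using e by (simp add: norm_divide field_simps)
  qed
  moreover have "connected (?f ` outside ?C)"
    by (intro connected_continuous_image cont JI) (use w inside_Int_outside[of ?C] in blast)
  moreover have "?f ` outside ?C \<inter> ?f ` ?C = {}"
    using outside_no_overlap[of ?C] inj[of UNIV] unfolding inj_on_def by fast
  ultimately show ?thesis
    using connected_same_side[of "?f ` outside ?C" "?f ` ?C" y "?f p"] y(1) x(1) p by blast
qed

text \<open>An inversion centred at an inside point brings both chords inside the image curve. Being
  injective, it preserves all intersections, so the inside case applies to the images.\<close>

lemma chords_not_both_outside:
  fixes c1 c2 P Q :: "real \<Rightarrow> complex"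
  assumes c1: "arc c1" "pathstart c1 = a" "pathfinish c1 = b"
    and c2: "arc c2" "pathstart c2 = a" "pathfinish c2 = b"
    and P: "arc P" "pathstart P = a" "pathfinish P = b"
    and Q: "arc Q" "pathstart Q = c" "pathfinish Q = d"
    and c12: "path_image c1 \<inter> path_image c2 = {a, b}"
    and c1P: "path_image c1 \<inter> path_image P = {a, b}"
    and c2P: "path_image c2 \<inter> path_image P = {a, b}"
    and c: "c \<in> path_image c1 - {a, b}" and d: "d \<in> path_image c2 - {a, b}"
    and Q_int: "path_image Q \<inter> (path_image c1 \<union> path_image c2 \<union> path_image P) \<subseteq> {c, d}"
    and p: "p \<in> path_image P - {a, b}" and q: "q \<in> path_image Q - {c, d}"
  shows "\<not> (p \<notin> inside (path_image c1 \<union> path_image c2) \<and> q \<notin> inside (path_image c1 \<union> path_image c2))"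
proof
  let ?C = "path_image c1 \<union> path_image c2"
  assume pq: "p \<notin> inside ?C \<and> q \<notin> inside ?C"
  note loop = simple_closed_two_arcs[OF c1 c2 c12]
  obtain w where w: "w \<in> inside ?C"
    using Jordan_inside_outside[OF loop(1,2)] loop(3) by auto
  define f where "f = (\<lambda>z. inverse (z - w))"
  have pq_out: "p \<in> outside ?C" "q \<in> outside ?C"
    using p q pq Q_int c1P c2P inside_Un_outside[of ?C] by blast+
  have side: "f x \<in> inside (f ` ?C)" if "x \<in> outside ?C" for x
    using inversion_outside[OF loop(1,2)] loop(3) w that by (simp add: f_def)
  have inj: "inj f" by (auto simp: inj_on_def f_def)
  \<comment> \<open>The centre has to avoid both chords for their images to be arcs. A chord with
    one point between its ends that is not inside has none inside, and its ends lie on the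
    curve.\<close>
  have wn: "w \<notin> path_image g"
    if g: "arc g" "path_image g \<inter> ?C \<subseteq> {pathstart g, pathfinish g}"
      "x \<in> path_image g - {pathstart g, pathfinish g}" "x \<notin> inside ?C" "{pathstart g, pathfinish g} \<subseteq> ?C"
    for g x
    using arc_points_same_side[OF g(1,2,3), of w] w g inside_no_overlap[of ?C] by blast
  have ab: "a \<in> ?C" "b \<in> ?C" using c12 by blast+
  have wP: "w \<notin> path_image P" by (rule wn[of P p]) (use P p pq c1P c2P ab in auto)
  have wQ: "w \<notin> path_image Q" by (rule wn[of Q q]) (use Q q pq Q_int c d in auto)
  have wC: "w \<notin> path_image c1" "w \<notin> path_image c2" using w inside_no_overlap[of ?C] by blast+
  have arc: "arc (f \<circ> g)" if "arc g" "w \<notin> path_image g" for g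
    using that path_continuous_image[of g f]
    by (fastforce simp: arc_def f_def inj_on_def intro!: continuous_intros)
  note im = path_image_compose image_Int[OF inj, symmetric] image_Un[symmetric]
  show False
  proof (rule notE[OF chords_not_both_inside[of "f \<circ> c1" "f a" "f b" "f \<circ> c2" "f \<circ> P" "f \<circ> Q" "f c" "f d" "f p" "f q"]])
    show "path_image (f \<circ> c1) \<inter> path_image (f \<circ> c2) = {f a, f b}"
      "path_image (f \<circ> c1) \<inter> path_image (f \<circ> P) = {f a, f b}"
      "path_image (f \<circ> c2) \<inter> path_image (f \<circ> P) = {f a, f b}"
      by (simp_all add: im c12 c1P c2P)
    have "f ` (path_image Q \<inter> (path_image c1 \<union> path_image c2 \<union> path_image P)) \<subseteq> f ` {c, d}"
      using Q_int by (rule image_mono)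
    then show "path_image (f \<circ> Q) \<inter> (path_image (f \<circ> c1) \<union> path_image (f \<circ> c2) \<union> path_image (f \<circ> P)) \<subseteq> {f c, f d}"
      by (simp add: im)
    show "f p \<in> inside (path_image (f \<circ> c1) \<union> path_image (f \<circ> c2)) \<and>
      f q \<in> inside (path_image (f \<circ> c1) \<union> path_image (f \<circ> c2))"
      using side pq_out by (simp add: im)
  qed (use c1 c2 P Q wC wP wQ c d p q in
      \<open>auto simp: arc pathstart_compose pathfinish_compose path_image_compose inj_eq[OF inj]\<close>)
qed

section \<open>Non-planarity of the complete graph on five vertices\<close>

lemma plane_drawing_clique_card:
  assumes drawing: "plane_drawing V E p \<gamma>" and "A \<subseteq> V"
    and clique: "\<And>u v. u \<in> A \<Longrightarrow> v \<in> A \<Longrightarrow> u \<noteq> v \<Longrightarrow> {u, v} \<in> E"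
  shows "card A \<le> 4"
proof (rule ccontr)
  assume "\<not> card A \<le> 4"
  then obtain B where B: "B \<subseteq> A" "card B = 5"
    using obtain_subset_with_card_n[of 5 A] by auto
  then obtain xs where xs: "set xs = B" "distinct xs" "length xs = 5"
    by (metis card.infinite distinct_card finite_distinct_list zero_neq_numeral)
  then obtain a b c d w where "xs = [a, b, c, d, w]"
    by (auto simp: length_Suc_conv numeral_eq_Suc)
  with xs have Beq: "B = {a, b, c, d, w}" and dist: "distinct [a, b, c, d, w]" by auto
  define M where "M u v = path_image (\<gamma> {u, v})" for u v
  \<comment> \<open>A drawing assigns a single path to each unordered edge; \<open>R u v\<close> is
    that path run from \<open>p u\<close> to \<open>p v\<close>.\<close>
  define R where "R u v = (if pathstart (\<gamma> {u, v}) = p u then \<gamma> {u, v} else reversepath (\<gamma> {u, v}))" for u v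
  have inj: "inj_on p B" using drawing B(1) \<open>A \<subseteq> V\<close> unfolding plane_drawing_def by (meson inj_on_subset)
  have E: "{u, v} \<in> E" if "u \<in> B" "v \<in> B" "u \<noteq> v" for u v using clique that B by blast
  have p_eq: "p u = p v \<longleftrightarrow> u = v" if "u \<in> B" "v \<in> B" for u v using inj that by (auto simp: inj_on_def)
  have M_sym: "M u v = M v u" for u v by (simp add: M_def insert_commute)
  have R: "arc (R u v)" "pathstart (R u v) = p u" "pathfinish (R u v) = p v" "path_image (R u v) = M u v"
    if uv: "u \<in> B" "v \<in> B" "u \<noteq> v" for u v
  proof -
    have *: "arc (\<gamma> {u, v})" "{pathstart (\<gamma> {u, v}), pathfinish (\<gamma> {u, v})} = {p u, p v}"
      using drawing E[OF uv] unfolding plane_drawing_def by auto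
    show "arc (R u v)" "pathstart (R u v) = p u" "pathfinish (R u v) = p v" "path_image (R u v) = M u v"
      using * p_eq uv by (auto simp: R_def M_def arc_reversepath doubleton_eq_iff)
  qed
  have ends: "p u \<in> M u v" "p v \<in> M u v" if "u \<in> B" "v \<in> B" "u \<noteq> v" for u v
    using R[OF that] pathstart_in_path_image[of "R u v"] pathfinish_in_path_image[of "R u v"] by auto
  \<comment> \<open>The relative interior of an edge misses all other edges, so a common point of
    two distinct edges is an end of both, and injectivity of \<open>p\<close> makes it the image of
    a shared vertex.\<close>
  have M_Int: "M u v \<inter> M x y = p ` ({u, v} \<inter> {x, y})"
    if h: "u \<in> B" "v \<in> B" "u \<noteq> v" "x \<in> B" "y \<in> B" "x \<noteq> y" "{u, v} \<noteq> {x, y}" for u v x y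
  proof
    have "(M u v - p ` {u, v}) \<inter> M x y = {}" "(M x y - p ` {x, y}) \<inter> M u v = {}"
      using drawing E h unfolding plane_drawing_def M_def by metis+
    then have "M u v \<inter> M x y \<subseteq> p ` {u, v} \<inter> p ` {x, y}" by blast
    also have "\<dots> = p ` ({u, v} \<inter> {x, y})"
      by (rule inj_on_image_Int[OF inj, symmetric]) (use h in auto)
    finally show "M u v \<inter> M x y \<subseteq> p ` ({u, v} \<inter> {x, y})" .
  qed (use h ends in auto)
  \<comment> \<open>The drawn 4-cycle through \<open>u\<close>, \<open>x\<close>, \<open>v\<close>,
    \<open>y\<close>, seen as two arcs from \<open>u\<close> to \<open>v\<close>.\<close>
  define D where "D u v x y = M u x \<union> M x v \<union> (M u y \<union> M y v)" for u v x y
  have join: "arc (R u x +++ R x v)" "pathstart (R u x +++ R x v) = p u"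
    "pathfinish (R u x +++ R x v) = p v" "path_image (R u x +++ R x v) = M u x \<union> M x v"
    if "u \<in> B" "v \<in> B" "x \<in> B" "distinct [u, v, x]" for u v x
  proof -
    have "M u x \<inter> M x v = {p x}" using that M_Int[of u x x v] by (auto simp: doubleton_eq_iff)
    then show "arc (R u x +++ R x v)" "pathstart (R u x +++ R x v) = p u"
      "pathfinish (R u x +++ R x v) = p v" "path_image (R u x +++ R x v) = M u x \<union> M x v"
      using that R[of u x] R[of x v] by (auto simp: arc_join path_image_join)
  qed
  \<comment> \<open>\<open>Q\<close> is left arbitrary so that it can be either the edge from
    \<open>x\<close> to \<open>y\<close> or a detour through a fifth vertex.\<close>
  have opposite: "y1 \<in> inside (D u v x y) \<longleftrightarrow> y2 \<notin> inside (D u v x y)"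
    if h: "u \<in> B" "v \<in> B" "x \<in> B" "y \<in> B" "distinct [u, v, x, y]"
      and Q: "arc Q" "pathstart Q = p x" "pathfinish Q = p y"
      "path_image Q \<inter> (M u x \<union> M x v \<union> (M u y \<union> M y v) \<union> M u v) \<subseteq> {p x, p y}"
      and y: "y1 \<in> M u v - {p u, p v}" "y2 \<in> path_image Q - {p x, p y}"
    for u v x y Q y1 y2
  proof -
    \<comment> \<open>The reversed list hands the simplifier each inequality in the other
      orientation.\<close>
    have h': "distinct [y, x, v, u]" using h by auto
    have ints: "(M u x \<union> M x v) \<inter> (M u y \<union> M y v) = {p u, p v}"
      "(M u x \<union> M x v) \<inter> M u v = {p u, p v}" "(M u y \<union> M y v) \<inter> M u v = {p u, p v}"
      using h h' by (simp_all add: M_Int insert_commute Int_Un_distrib Int_Un_distrib2 doubleton_eq_iff)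
    have mem: "p x \<in> (M u x \<union> M x v) - {p u, p v}" "p y \<in> (M u y \<union> M y v) - {p u, p v}"
      using h ends p_eq by auto
    have arcs: "distinct [u, v, x]" "distinct [u, v, y]" "u \<noteq> v" using h by auto
    note j = join[OF h(1,2,3) arcs(1)] join[OF h(1,2,4) arcs(2)] R[OF h(1,2) arcs(3)]
    note facts = j(1-3,5-7,9-11) Q(1-3)
    have "\<not> (y1 \<in> inside (D u v x y) \<and> y2 \<in> inside (D u v x y))"
      using chords_not_both_inside[OF facts, unfolded j(4,8,12)] ints mem Q(4) y unfolding D_def by blast
    moreover have "\<not> (y1 \<notin> inside (D u v x y) \<and> y2 \<notin> inside (D u v x y))"
      using chords_not_both_outside[OF facts, unfolded j(4,8,12)] ints mem Q(4) y unfolding D_def by blast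
    ultimately show ?thesis by blast
  qed
  have mid: "\<exists>z. z \<in> M u v - {p u, p v}" if "u \<in> B" "v \<in> B" "u \<noteq> v" for u v
    using nonempty_simple_path_endless[of "R u v"] R[OF that] arc_imp_simple_path by auto
  \<comment> \<open>Here \<open>Q\<close> is the detour from \<open>x\<close> to \<open>y\<close>
    through \<open>t\<close>, which has \<open>p t\<close> between its ends.\<close>
  have vertex: "y1 \<in> inside (D u v x y) \<longleftrightarrow> p t \<notin> inside (D u v x y)"
    if h: "u \<in> B" "v \<in> B" "x \<in> B" "y \<in> B" "t \<in> B" "distinct [u, v, x, y, t]"
      and y1: "y1 \<in> M u v - {p u, p v}" for u v x y t y1
  proof (rule opposite)
    have dxyt: "distinct [x, y, t]" and h': "distinct [t, y, x, v, u]" using h by auto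
    note j = join[OF h(3,4,5) dxyt]
    show "arc (R x t +++ R t y)" "pathstart (R x t +++ R t y) = p x" "pathfinish (R x t +++ R t y) = p y"
      by (fact j)+
    show "path_image (R x t +++ R t y) \<inter> (M u x \<union> M x v \<union> (M u y \<union> M y v) \<union> M u v) \<subseteq> {p x, p y}"
      unfolding j(4) using h h' by (simp_all add: M_Int insert_commute Int_Un_distrib Int_Un_distrib2 doubleton_eq_iff)
    show "p t \<in> path_image (R x t +++ R t y) - {p x, p y}"
      unfolding j(4) using h ends p_eq by auto
  qed (use h y1 in auto)
  have mem: "a \<in> B" "b \<in> B" "c \<in> B" "d \<in> B" "w \<in> B" by (auto simp: Beq)
  have ne: "a \<noteq> b" "c \<noteq> d" and dist': "distinct [w, d, c, b, a]" using dist by auto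
  obtain y1 y2 where y: "y1 \<in> M a b - {p a, p b}" "y2 \<in> M c d - {p c, p d}"
    using mid mem ne by blast
  \<comment> \<open>Both chords belong to the same cycle, so the three statements below concern one
    curve, and three truth values cannot be pairwise different.\<close>
  have D_swap: "D c d a b = D a b c d" unfolding D_def using M_sym by blast
  have "y1 \<in> inside (D a b c d) \<longleftrightarrow> y2 \<notin> inside (D a b c d)"
  proof (rule opposite)
    show "arc (R c d)" "pathstart (R c d) = p c" "pathfinish (R c d) = p d" using R mem ne by auto
    show "path_image (R c d) \<inter> (M a c \<union> M c b \<union> (M a d \<union> M d b) \<union> M a b) \<subseteq> {p c, p d}"
      unfolding R(4)[OF mem(3,4) ne(2)] using mem dist dist'
      by (simp add: M_Int insert_commute Int_Un_distrib Int_Un_distrib2 doubleton_eq_iff)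
    show "y2 \<in> path_image (R c d) - {p c, p d}" using y R mem ne by auto
  qed (use mem dist y in auto)
  moreover have "y1 \<in> inside (D a b c d) \<longleftrightarrow> p w \<notin> inside (D a b c d)"
    by (rule vertex) (use mem dist y in auto)
  moreover have "y2 \<in> inside (D c d a b) \<longleftrightarrow> p w \<notin> inside (D c d a b)"
    by (rule vertex) (use mem dist y in auto)
  ultimately show False using D_swap by auto
qed

lemma planar_clique_card:
  assumes "planar V E" "A \<subseteq> V" "\<And>u v. u \<in> A \<Longrightarrow> v \<in> A \<Longrightarrow> u \<noteq> v \<Longrightarrow> {u, v} \<in> E"
  shows "card A \<le> 4"
proof -
  obtain p \<gamma> where "plane_drawing V E p \<gamma>" using assms(1) unfolding planar_def by blast
  then show ?thesis using assms(2,3) by (rule plane_drawing_clique_card)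
qed

section \<open>Auxiliary group theory: centres, involutions, dihedral groups\<close>

context group
begin

text \<open>By the class equation: conjugacy classes have \<open>p\<close>-power size, and without a
  nontrivial central element only the class of \<open>\<one>\<close> is a singleton. Then
  \<open>p\<close> divides the size of every other class as well as the group order, hence also
  1.\<close>

lemma pow_prime_order_center_nontrivial:
  assumes "Factorial_Ring.prime p" "order G = p ^ n" "n > 0"
  obtains z where "z \<in> carrier G" "z \<noteq> \<one>" "\<And>g. g \<in> carrier G \<Longrightarrow> g \<otimes> z = z \<otimes> g"
proof (rule ccontr)
  note central = that
  assume "\<not> thesis"
  then have no_central: "\<exists>g\<in>carrier G. g \<otimes> z \<noteq> z \<otimes> g" if "z \<in> carrier G" "z \<noteq> \<one>" for z
    using that central by blast
  let ?\<phi> = "\<lambda>g. \<lambda>h \<in> carrier G. g \<otimes> h \<otimes> inv g"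
  interpret conj: group_action G "carrier G" ?\<phi> by (rule action_by_conjugation)
  let ?O = "orbits G (carrier G) ?\<phi>"
  have p_gt: "p > 1" using assms(1) by (rule prime_gt_1_nat)
  then have fin: "finite (carrier G)"
    using assms(2) order_gt_0_iff_finite by simp
  have finO: "finite ?O" using fin by (simp add: orbits_def)
  have orbit_one: "orbit G ?\<phi> \<one> = {\<one>}"
    unfolding orbit_def by (auto intro: exI[of _ \<one>])
  have one_O: "{\<one>} \<in> ?O" unfolding orbits_def using orbit_one by force
  have dvd: "p dvd card B" if B: "B \<in> ?O - {{\<one>}}" for B
  proof -
    obtain x where x: "x \<in> carrier G" "B = orbit G ?\<phi> x"
      using B by (auto simp: orbits_def)
    then have "x \<noteq> \<one>" using B orbit_one by auto
    then obtain g where g: "g \<in> carrier G" "g \<otimes> x \<noteq> x \<otimes> g" using no_central x by blast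
    have "card B dvd p ^ n"
      using conj.orbit_stabilizer_theorem[OF x(1)] unfolding x(2) assms(2) by (intro dvdI) (rule sym)
    then obtain k where k: "card B = p ^ k" using divides_primepow_nat[OF assms(1)] by blast
    have "x \<in> B" "g \<otimes> x \<otimes> inv g \<in> B"
      using conj.orbit_refl[OF x(1)] x g by (auto simp: orbit_def)
    moreover have "g \<otimes> x \<otimes> inv g \<noteq> x"
      using g x by (metis inv_solve_right' m_closed)
    ultimately have "card B \<noteq> 1" by (auto simp: card_1_singleton_iff)
    then have "k > 0" using k by (cases k) auto
    then show ?thesis using k by simp
  qed
  \<comment> \<open>Summing the constant 1 over all orbits counts the carrier.\<close>
  have "order G = (\<Sum>B\<in>?O. card B)"
    using conj.disjoint_sum[OF fin, of "\<lambda>_. 1::nat"] by (simp add: order_def)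
  also have "\<dots> = 1 + (\<Sum>B\<in>?O - {{\<one>}}. card B)"
    using sum.remove[OF finO one_O, of card] by simp
  finally have "1 + (\<Sum>B\<in>?O - {{\<one>}}. card B) = p ^ n" using assms(2) by simp
  then have "p dvd 1 + (\<Sum>B\<in>?O - {{\<one>}}. card B)" using assms(3) by simp
  moreover have "p dvd (\<Sum>B\<in>?O - {{\<one>}}. card B)" using dvd by (intro dvd_sum) auto
  ultimately have "p dvd 1" by (simp only: dvd_add_left_iff)
  then show False using p_gt by simp
qed

text \<open>Inverting a product swaps the inverses of its factors; when every element is its own
  inverse, this says that the factors commute.\<close>

lemma comm_group_if_all_involutions:
  assumes "\<And>x. x \<in> carrier G \<Longrightarrow> x \<otimes> x = \<one>"
  shows "comm_group G"
proof (rule group_comm_groupI)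
  fix x y assume xy: "x \<in> carrier G" "y \<in> carrier G"
  have self_inv: "inv u = u" if "u \<in> carrier G" for u
    using assms that inv_equality by blast
  show "x \<otimes> y = y \<otimes> x"
    using inv_mult_group[OF xy] xy by (simp add: self_inv)
qed

text \<open>The isomorphism sends \<open>(i, s)\<close> to \<open>x [^] i\<close>, followed by
  \<open>g\<close> if \<open>s\<close> holds. It is multiplicative because \<open>g\<close> inverts
  \<open>x\<close>, the two cosets are separated because \<open>g\<close> is no power of
  \<open>x\<close>, and they cover the group by \<open>cover\<close>.\<close>

lemma dihedral_group_iso:
  assumes x: "x \<in> carrier G" and g: "g \<in> carrier G" "g \<otimes> g = \<one>" "g \<otimes> x = inv x \<otimes> g"
    and "ord x > 0" and notin: "g \<notin> generate G {x}"
    and cover: "\<And>h. h \<in> carrier G \<Longrightarrow> h \<in> generate G {x} \<or> h \<otimes> g \<in> generate G {x}"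
  shows "G \<cong> dihedral_group (ord x)"
proof -
  let ?n = "int (ord x)"
  let ?D = "dihedral_group (ord x)"
  define f where "f = (\<lambda>(i::int, s). x [^] i \<otimes> (if s then g else \<one>))"
  have gen: "generate G {x} = range (\<lambda>k::int. x [^] k)"
    using generate_pow[OF x] by auto
  have pow_mod: "x [^] (k mod ?n) = x [^] k" for k :: int
    using x by (simp add: int_pow_eq)
  have g_nat_pow: "g \<otimes> x [^] m = inv x [^] m \<otimes> g" for m :: nat
  proof (induction m)
    case (Suc m)
    have "g \<otimes> x [^] Suc m = (g \<otimes> x [^] m) \<otimes> x" using x g by (simp add: m_assoc)
    also have "\<dots> = inv x [^] m \<otimes> (g \<otimes> x)" unfolding Suc.IH using x g by (simp add: m_assoc)
    also have "\<dots> = inv x [^] Suc m \<otimes> g" unfolding g(3) using x g by (simp add: m_assoc)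
    finally show ?case .
  qed (use x g in auto)
  \<comment> \<open>Exponents in the carrier of \<open>?D\<close> are nonnegative, so the induction
    over naturals reaches all that occur.\<close>
  have g_pow: "g \<otimes> x [^] j = x [^] (- j) \<otimes> g" if nonneg: "0 \<le> j" for j :: int
  proof -
    obtain m where "j = int m" by (rule nonneg_int_cases[OF nonneg])
    then show ?thesis using g_nat_pow[of m] x by (simp add: int_pow_int int_pow_neg nat_pow_inv)
  qed
  have "f \<in> hom ?D G"
  proof (rule homI)
    fix a assume "a \<in> carrier ?D"
    then show "f a \<in> carrier G" using x g by (auto simp: f_def split: prod.split)
  next
    fix a b assume "a \<in> carrier ?D" "b \<in> carrier ?D"
    then obtain i s j t where ab: "a = (i, s)" "b = (j, t)" and j: "0 \<le> j"
      by (auto simp: dihedral_group_def)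
    show "f (a \<otimes>\<^bsub>?D\<^esub> b) = f a \<otimes> f b"
    proof (cases s)
      case True
      \<comment> \<open>The reflection factor of \<open>b\<close>; naming it treats both values of
        \<open>t\<close> at once.\<close>
      define u where "u = (if t then g else \<one>)"
      have u: "u \<in> carrier G" "g \<otimes> u = (if s \<noteq> t then g else \<one>)"
        using g True by (auto simp: u_def)
      have "f a \<otimes> f b = x [^] i \<otimes> (g \<otimes> x [^] j) \<otimes> u"
        using x g u True by (simp add: ab f_def m_assoc u_def[symmetric])
      also have "\<dots> = x [^] (i - j) \<otimes> (g \<otimes> u)"
        unfolding g_pow[OF j] using x g(1) u(1) int_pow_mult[OF x, of i "- j"] by (simp add: m_assoc[symmetric])
      also have "\<dots> = f (a \<otimes>\<^bsub>?D\<^esub> b)"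
        using True by (simp add: ab f_def dihedral_group_def pow_mod u(2))
      finally show ?thesis by simp
    next
      case False
      then show ?thesis
        using x g by (auto simp: ab f_def dihedral_group_def pow_mod int_pow_mult m_assoc)
    qed
  qed
  moreover have "inj_on f (carrier ?D)"
  proof (rule inj_onI)
    fix a b assume a: "a \<in> carrier ?D" and b: "b \<in> carrier ?D" and eq: "f a = f b"
    have pow_inj: "i = j" if "x [^] i = x [^] j" "0 \<le> i" "i < ?n" "0 \<le> j" "j < ?n" for i j :: int
    proof -
      have "j mod ?n = i mod ?n"
        using that(1) int_pow_eq[OF x] by (simp add: mod_eq_dvd_iff)
      then show ?thesis using that by simp
    qed
    \<comment> \<open>Hence the second component of a pair can be read off from its image.\<close>
    have no: "x [^] i \<noteq> x [^] j \<otimes> g" for i j :: int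
    proof
      assume "x [^] i = x [^] j \<otimes> g"
      then have "g = inv (x [^] j) \<otimes> x [^] i"
        using x g(1) inv_solve_left[of g "x [^] j" "x [^] i"] by simp
      also have "\<dots> = x [^] (- j + i)" using x by (simp only: int_pow_mult int_pow_neg)
      finally show False using notin gen by blast
    qed
    obtain i s j t where ab: "a = (i, s)" "b = (j, t)" "0 \<le> i" "i < ?n" "0 \<le> j" "j < ?n"
      using a b by (auto simp: dihedral_group_def)
    have "s = t" using eq no[of i j] no[of j i] x by (cases s; cases t) (simp_all add: ab f_def)
    moreover from this have "x [^] i = x [^] j"
      using eq x g(1) by (cases t) (simp_all add: ab f_def)
    ultimately show "a = b" using pow_inj ab by simp
  qed
  moreover have "f ` carrier ?D = carrier G"
  proof
    show "f ` carrier ?D \<subseteq> carrier G" using x g by (auto simp: f_def)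
    show "carrier G \<subseteq> f ` carrier ?D"
    proof
      fix h assume h: "h \<in> carrier G"
      have mem: "x [^] k \<otimes> (if s then g else \<one>) \<in> f ` carrier ?D" for k :: int and s
      proof -
        have "f (k mod ?n, s) = x [^] k \<otimes> (if s then g else \<one>)" by (simp add: f_def pow_mod)
        moreover have "(k mod ?n, s) \<in> carrier ?D"
          using \<open>ord x > 0\<close> by (simp add: dihedral_group_def)
        ultimately show ?thesis by (metis imageI)
      qed
      from cover[OF h] show "h \<in> f ` carrier ?D"
      proof
        assume "h \<in> generate G {x}"
        then obtain k :: int where "h = x [^] k" using gen by auto
        then show ?thesis using mem[of k False] x by simp
      next
        assume "h \<otimes> g \<in> generate G {x}"
        then obtain k :: int where k: "h \<otimes> g = x [^] k" using gen by auto
        have "h = h \<otimes> g \<otimes> g" using h g by (simp add: m_assoc)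
        then show ?thesis using mem[of k True] k by simp
      qed
    qed
  qed
  ultimately have "f \<in> iso ?D G" by (simp add: iso_iff)
  then have "?D \<cong> G" by (rule is_isoI)
  then show ?thesis
    using group.iso_sym[OF group_dihedral_group[OF \<open>ord x > 0\<close>]] by blast
qed

section \<open>Constraints that planarity puts on the elements\<close>

lemma planar_gpg_common_power_card:
  assumes planar: "planar (gpg_verts G) (gpg_edges G)" and "t \<noteq> \<one>"
    and A: "\<And>a. a \<in> A \<Longrightarrow> a \<in> carrier G \<and> (\<exists>k::nat. a [^] k = t)"
  shows "card A \<le> 4"
proof (rule planar_clique_card[OF planar])
  have t: "t \<in> generate G {a}" if "a \<in> A" for a
    using A[OF that] generate_pow[of a] by (auto simp: int_pow_int[symmetric])
  show verts: "A \<subseteq> gpg_verts G"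
    using A \<open>t \<noteq> \<one>\<close> by (fastforce simp: gpg_verts_def)
  fix u v assume "u \<in> A" "v \<in> A" "u \<noteq> v"
  with verts t \<open>t \<noteq> \<one>\<close> show "{u, v} \<in> gpg_edges G"
    unfolding gpg_edges_def by blast
qed

text \<open>An element violating this has order at least 8, and so a power \<open>y\<close> of order
  8. Then \<open>y\<close>, \<open>y^3\<close>, \<open>y^5\<close>, \<open>y^7\<close> and
  \<open>y^4\<close> are five elements with the common nontrivial power \<open>y^4\<close>.\<close>

lemma planar_gpg_two_group_exponent:
  assumes planar: "planar (gpg_verts G) (gpg_edges G)"
    and ord: "order G = 2 ^ n" and x: "x \<in> carrier G"
  shows "x [^] (4::nat) = \<one>"
proof (rule ccontr)
  assume not_one: "x [^] (4::nat) \<noteq> \<one>"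
  obtain k where k: "ord x = 2 ^ k"
    using ord_dvd_group_order[OF x] ord divides_primepow_nat[of 2 "ord x" n] two_is_prime_nat by auto
  have "\<not> 2 ^ k dvd (2 ^ 2 :: nat)" using not_one x k pow_eq_id[of x 4] by simp
  then have "k \<ge> 3" using le_imp_power_dvd[of k 2 "2::nat"] by linarith
  \<comment> \<open>The exponent divides \<open>ord x = 2 ^ k\<close> with quotient 8.\<close>
  define y where "y = x [^] (2 ^ (k - 3) :: nat)"
  have y: "y \<in> carrier G" using x by (simp add: y_def)
  have "(2::nat) ^ k = 2 ^ 3 * 2 ^ (k - 3)" using \<open>k \<ge> 3\<close> power_add[of "2::nat" 3 "k - 3"] by simp
  then have ord_y: "ord y = 8"
    unfolding y_def using ord_pow[OF x, of "2 ^ (k - 3)"] k by simp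
  have y_four: "y [^] (4::nat) \<noteq> \<one>" using y ord_y pow_eq_id[of y 4] by simp
  have y8: "y [^] (8 * m) = \<one>" for m :: nat using y ord_y pow_eq_id[of y "8 * m"] by simp
  \<comment> \<open>For odd \<open>j\<close>, \<open>4 * j\<close> is congruent to 4 modulo
    8.\<close>
  have odd: "(y [^] j) [^] (4::nat) = y [^] (4::nat)" if odd_j: "odd j" for j :: nat
  proof -
    obtain m where "j = 2 * m + 1" by (rule oddE[OF odd_j])
    then have "j * 4 = 8 * m + 4" by simp
    then show ?thesis using y y8[of m] by (simp add: nat_pow_pow flip: nat_pow_mult)
  qed
  let ?J = "{1, 3, 4, 5, 7} :: nat set"
  have "card ((\<lambda>j. y [^] j) ` ?J) \<le> 4"
  proof (rule planar_gpg_common_power_card[OF planar y_four])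
    fix a assume "a \<in> (\<lambda>j. y [^] j) ` ?J"
    then obtain j where j: "j \<in> ?J" "a = y [^] j" by blast
    have "a [^] (if j = 4 then 1 else 4 :: nat) = y [^] (4::nat)"
      using j y odd[of j] by auto
    then show "a \<in> carrier G \<and> (\<exists>k::nat. a [^] k = y [^] (4::nat))" using j y by auto
  qed
  moreover have "inj_on (\<lambda>j. y [^] j) ?J"
    using ord_inj[OF y] by (rule inj_on_subset) (simp add: ord_y)
  ultimately show False by (simp add: card_image)
qed

text \<open>Otherwise \<open>a\<close>, \<open>b\<close>, their inverses and \<open>t\<close> would
  be five elements with \<open>t\<close> as a common power. They are distinct because a square root
  of an involution has order 4 and so differs from its inverse and from \<open>t\<close>.\<close>

lemma planar_gpg_square_roots:
  assumes planar: "planar (gpg_verts G) (gpg_edges G)"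
    and a: "a \<in> carrier G" "a \<otimes> a = t" and b: "b \<in> carrier G" "b \<otimes> b = t"
    and t: "t \<noteq> \<one>" "t \<otimes> t = \<one>"
  shows "b = a \<or> b = inv a"
proof (rule ccontr)
  assume "\<not> ?thesis"
  then have ne: "b \<noteq> a" "b \<noteq> inv a" "inv b \<noteq> a" using a b by auto
  have tc: "t \<in> carrier G" using a by auto
  have inv_t: "inv t = t" using t(2) tc inv_equality by blast
  have sq_inv: "inv y \<otimes> inv y = t" if "y \<in> carrier G" "y \<otimes> y = t" for y
    using that inv_t by (metis inv_mult_group)
  have ne_inv: "inv y \<noteq> y" if "y \<in> carrier G" "y \<otimes> y = t" for y
    using that t(1) r_inv by metis
  have ne_t: "y \<noteq> t" if "y \<otimes> y = t" for y using that t by auto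
  let ?A = "{a, inv a, b, inv b, t}"
  have "card ?A \<le> 4"
  proof (rule planar_gpg_common_power_card[OF planar t(1)])
    fix y assume y: "y \<in> ?A"
    then have "y \<in> carrier G" "y = t \<or> y \<otimes> y = t" using a b tc sq_inv by auto
    moreover have "y [^] (1::nat) = y" "y [^] (2::nat) = y \<otimes> y"
      using calculation(1) by (auto simp: numeral_2_eq_2)
    ultimately show "y \<in> carrier G \<and> (\<exists>k::nat. y [^] k = t)" by metis
  qed
  moreover have "card ?A = 5"
  proof -
    have "inv a \<noteq> inv b" "inv a \<noteq> b" using ne a b by (metis inv_inv)+
    moreover have "a \<noteq> t" "b \<noteq> t" "inv a \<noteq> t" "inv b \<noteq> t"
      using ne_t a b sq_inv by blast+
    ultimately show ?thesis
      using ne ne_inv[OF a] ne_inv[OF b] by (auto simp: card_insert_if)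
  qed
  ultimately show False by simp
qed

end

section \<open>Determination of the group\<close>

theorem theorem5p2:
  fixes G :: "('a, 'm) monoid_scheme"
  assumes "group G"
    and "finite (carrier G)"
    and "\<exists>n. Coset.order G = 2 ^ n"
    and "\<not> comm_group G"
    and "planar (gpg_verts G) (gpg_edges G)"
  shows "G \<cong> D8"
proof -
  interpret group G by fact
  note planar = assms(5)
  obtain n where n: "order G = 2 ^ n" using assms(3) by blast
  have "n \<noteq> 0"
  proof
    assume "n = 0"
    then have "carrier G = {\<one>\<^bsub>G\<^esub>}" using n one_closed by (metis card_1_singletonE order_def power_0 singletonD)
    then show False using assms(4) comm_group_if_all_involutions by auto
  qed
  have sq_sq: "y \<otimes>\<^bsub>G\<^esub> y \<otimes>\<^bsub>G\<^esub> (y \<otimes>\<^bsub>G\<^esub> y) = \<one>\<^bsub>G\<^esub>" if "y \<in> carrier G" for y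
    using planar_gpg_two_group_exponent[OF planar n that] that
    by (simp add: numeral_eq_Suc m_assoc)
  obtain c where c: "c \<in> carrier G" "c \<noteq> \<one>\<^bsub>G\<^esub>" "\<And>g. g \<in> carrier G \<Longrightarrow> g \<otimes>\<^bsub>G\<^esub> c = c \<otimes>\<^bsub>G\<^esub> g"
    using pow_prime_order_center_nontrivial[OF two_is_prime_nat n] \<open>n \<noteq> 0\<close> by blast
  \<comment> \<open>Since \<open>c\<close> has order 2 or 4, either \<open>c\<close> or its square
    is a central involution.\<close>
  define z where "z = (if c \<otimes>\<^bsub>G\<^esub> c = \<one>\<^bsub>G\<^esub> then c else c \<otimes>\<^bsub>G\<^esub> c)"
  have z: "z \<in> carrier G" "z \<noteq> \<one>\<^bsub>G\<^esub>" "z \<otimes>\<^bsub>G\<^esub> z = \<one>\<^bsub>G\<^esub>"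
    using c(1,2) sq_sq[of c] by (auto simp: z_def)
  have z_central: "g \<otimes>\<^bsub>G\<^esub> z = z \<otimes>\<^bsub>G\<^esub> g" if "g \<in> carrier G" for g
  proof -
    have "g \<otimes>\<^bsub>G\<^esub> (c \<otimes>\<^bsub>G\<^esub> c) = c \<otimes>\<^bsub>G\<^esub> c \<otimes>\<^bsub>G\<^esub> g" using that c by (metis m_assoc)
    then show ?thesis using c(3)[OF that] by (simp add: z_def)
  qed
  \<comment> \<open>\<open>y\<close> and \<open>y z\<close> have the same square, an involution, so
    \<open>y z\<close> is \<open>y\<close> or its inverse. The former would make \<open>z\<close>
    trivial; the latter says that \<open>y y z\<close> is trivial.\<close>
  have sq_z: "y \<otimes>\<^bsub>G\<^esub> y = z" if y: "y \<in> carrier G" "y \<otimes>\<^bsub>G\<^esub> y \<noteq> \<one>\<^bsub>G\<^esub>" for y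
  proof -
    have "y \<otimes>\<^bsub>G\<^esub> z \<otimes>\<^bsub>G\<^esub> (y \<otimes>\<^bsub>G\<^esub> z) = y \<otimes>\<^bsub>G\<^esub> y \<otimes>\<^bsub>G\<^esub> (z \<otimes>\<^bsub>G\<^esub> z)"
      using y z z_central by (metis m_assoc m_closed)
    then have "y \<otimes>\<^bsub>G\<^esub> z \<otimes>\<^bsub>G\<^esub> (y \<otimes>\<^bsub>G\<^esub> z) = y \<otimes>\<^bsub>G\<^esub> y" using y z by simp
    then have "y \<otimes>\<^bsub>G\<^esub> z = y \<or> y \<otimes>\<^bsub>G\<^esub> z = inv\<^bsub>G\<^esub> y"
      using planar_gpg_square_roots[OF planar, of y _ "y \<otimes>\<^bsub>G\<^esub> z"] y z sq_sq by auto
    then have "y \<otimes>\<^bsub>G\<^esub> (y \<otimes>\<^bsub>G\<^esub> z) = \<one>\<^bsub>G\<^esub>" using y z by auto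
    then have "y \<otimes>\<^bsub>G\<^esub> y \<otimes>\<^bsub>G\<^esub> z = \<one>\<^bsub>G\<^esub>" using y z by (simp add: m_assoc)
    then show ?thesis using y z by (metis inv_equality inv_unique' m_closed)
  qed
  obtain x where x: "x \<in> carrier G" "x \<otimes>\<^bsub>G\<^esub> x \<noteq> \<one>\<^bsub>G\<^esub>"
    using comm_group_if_all_involutions assms(4) by blast
  let ?C = "generate G {x}"
  have gen: "?C = range (\<lambda>k::int. x [^]\<^bsub>G\<^esub> k)" using generate_pow[OF x(1)] by auto
  have C: "subgroup ?C G" using x by (intro generate_is_subgroup) auto
  have xC: "x \<in> ?C" by (rule generate.incl) simp
  \<comment> \<open>Otherwise \<open>y\<close> is a square root of \<open>z\<close>, just as
    \<open>x\<close> is, and thus equals \<open>x\<close> or its inverse.\<close>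
  have involution: "y \<otimes>\<^bsub>G\<^esub> y = \<one>\<^bsub>G\<^esub>" if y: "y \<in> carrier G" "y \<notin> ?C" for y
  proof (rule ccontr)
    assume "y \<otimes>\<^bsub>G\<^esub> y \<noteq> \<one>\<^bsub>G\<^esub>"
    then have "y = x \<or> y = inv\<^bsub>G\<^esub> x"
      using planar_gpg_square_roots[OF planar x(1) sq_z[OF x] y(1)] sq_z y z by blast
    then show False using y xC subgroup.m_inv_closed[OF C xC] by blast
  qed
  have x_inv: "inv\<^bsub>G\<^esub> x \<noteq> x" using x r_inv by metis
  \<comment> \<open>Both \<open>g\<close> and \<open>g x\<close> lie outside \<open>?C\<close>, so
    both are involutions, and inverting \<open>g x\<close> gives the relation.\<close>
  have invert: "g \<otimes>\<^bsub>G\<^esub> x = inv\<^bsub>G\<^esub> x \<otimes>\<^bsub>G\<^esub> g" if g: "g \<in> carrier G" "g \<notin> ?C" for g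
  proof -
    have "g \<otimes>\<^bsub>G\<^esub> x \<notin> ?C"
      using subgroup.m_closed[OF C _ subgroup.m_inv_closed[OF C xC], of "g \<otimes>\<^bsub>G\<^esub> x"] g x
      by (auto simp: m_assoc)
    then have "inv\<^bsub>G\<^esub> (g \<otimes>\<^bsub>G\<^esub> x) = g \<otimes>\<^bsub>G\<^esub> x" "inv\<^bsub>G\<^esub> g = g"
      using involution g x inv_equality by auto
    then show ?thesis using inv_mult_group[OF g(1) x(1)] by simp
  qed
  \<comment> \<open>A product of two elements inverting \<open>x\<close> commutes with
    \<open>x\<close>. Outside \<open>?C\<close> it would also invert \<open>x\<close>, making
    \<open>x\<close> its own inverse.\<close>
  have index_two: "g \<otimes>\<^bsub>G\<^esub> h \<in> ?C"
    if g: "g \<in> carrier G" "g \<notin> ?C" and h: "h \<in> carrier G" "h \<notin> ?C" for g h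
  proof (rule ccontr)
    assume gh: "g \<otimes>\<^bsub>G\<^esub> h \<notin> ?C"
    have "inv\<^bsub>G\<^esub> x \<otimes>\<^bsub>G\<^esub> (g \<otimes>\<^bsub>G\<^esub> h) = g \<otimes>\<^bsub>G\<^esub> h \<otimes>\<^bsub>G\<^esub> x" using invert[of "g \<otimes>\<^bsub>G\<^esub> h"] gh g h by simp
    also have "\<dots> = g \<otimes>\<^bsub>G\<^esub> inv\<^bsub>G\<^esub> x \<otimes>\<^bsub>G\<^esub> h" using invert[OF h] g h x by (simp add: m_assoc)
    also have "g \<otimes>\<^bsub>G\<^esub> inv\<^bsub>G\<^esub> x = x \<otimes>\<^bsub>G\<^esub> g"
      using invert[OF g] g x by (metis inv_closed inv_solve_left inv_solve_right m_assoc m_closed)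
    finally have "inv\<^bsub>G\<^esub> x \<otimes>\<^bsub>G\<^esub> (g \<otimes>\<^bsub>G\<^esub> h) = x \<otimes>\<^bsub>G\<^esub> (g \<otimes>\<^bsub>G\<^esub> h)" using g h x by (simp add: m_assoc)
    then show False using x_inv g h x by simp
  qed
  \<comment> \<open>Otherwise the group would be cyclic, hence abelian.\<close>
  have "\<exists>g\<in>carrier G. g \<notin> ?C"
  proof (rule ccontr)
    assume "\<not> ?thesis"
    then have powers: "\<exists>k::int. y = x [^]\<^bsub>G\<^esub> k" if "y \<in> carrier G" for y using that gen by auto
    have "comm_group G"
    proof (rule group_comm_groupI)
      fix a b assume "a \<in> carrier G" "b \<in> carrier G"
      then obtain k l :: int where "a = x [^]\<^bsub>G\<^esub> k" "b = x [^]\<^bsub>G\<^esub> l" using powers by blast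
      then show "a \<otimes>\<^bsub>G\<^esub> b = b \<otimes>\<^bsub>G\<^esub> a" using x by (simp add: int_pow_mult[symmetric] add.commute)
    qed
    then show False using assms(4) by contradiction
  qed
  then obtain g where g: "g \<in> carrier G" "g \<notin> ?C" by blast
  have ord_x: "ord x = 4"
  proof -
    have "x [^]\<^bsub>G\<^esub> (2::nat) \<noteq> \<one>\<^bsub>G\<^esub>" using x by (simp add: numeral_2_eq_2)
    then have "\<not> ord x dvd 2" using pow_eq_id[OF x(1)] by blast
    moreover have "ord x dvd 2 ^ 2"
      using pow_eq_id[OF x(1)] planar_gpg_two_group_exponent[OF planar n x(1)] by simp
    ultimately obtain k where k: "k \<le> 2" "ord x = 2 ^ k" "\<not> (2::nat) ^ k dvd 2"
      using divides_primepow_nat[OF two_is_prime_nat, of "ord x" 2] by auto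
    then show ?thesis by (auto simp: le_Suc_eq numeral_2_eq_2)
  qed
  have "G \<cong> dihedral_group (ord x)"
  proof (rule dihedral_group_iso[OF x(1) g(1) involution[OF g] invert[OF g] _ g(2)])
    show "ord x > 0" by (simp add: ord_x)
    show "h \<in> ?C \<or> h \<otimes>\<^bsub>G\<^esub> g \<in> ?C" if "h \<in> carrier G" for h
      using index_two[OF that _ g] by blast
  qed
  then show ?thesis by (simp add: ord_x)
qed

end
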